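(* If $\mathcal G$ is a simple graph on $m$ vertices ($m$ a positive integer), then there exists $m'\in \mathbb N$, with $m'>1$ not prime, such that $\mathcal G$ is (isomorphic to) an induced subgraph of $\mathcal P(\mathbb Z_{m'})$.
   Context: For a finite group $G$ that is neither trivial nor of prime order, the coprime graph of subgroups $\mathcal P(G)$ is the simple graph whose vertices are the proper subgroups of $G$ (here "proper" means different from $G$ and from the trivial subgroup), two distinct vertices $H,K$ being adjacent if and only if $|H|$ and $|K|$ are coprime. *)

theory Defs
  imports
    "HOL-Algebra.Elementary_Groups"
    "HOL-Computational_Algebra.Primes"
    "Graph_Theory.Graph_Theory"
begin

text \<open>
  As in the theory of symmetric digraphs used here, an edge between \<open>H\<close> and \<open>K\<close> is represented
  by the two arcs \<open>(H, K)\<close> and \<open>(K, H)\<close>. The definition is meant for finite groups: in an infinite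
  group \<^const>\<open>card\<close> takes the value 0 on infinite subgroups.
\<close>

definition coprime_subgroup_graph :: "('a, 'b) monoid_scheme \<Rightarrow> 'a set pair_pre_digraph" where
  "coprime_subgroup_graph G =
     (let V = {H. subgroup H G \<and> H \<noteq> carrier G \<and> H \<noteq> {\<one>\<^bsub>G\<^esub>}}
      in \<lparr> pverts = V,
           parcs = {(H, K). H \<in> V \<and> K \<in> V \<and> H \<noteq> K \<and> coprime (card H) (card K)} \<rparr>)"

lemma pair_graph_coprime_subgroup_graph:
  assumes "finite (carrier G)"
  shows "pair_graph (coprime_subgroup_graph G)"
proof -
  let ?P = "coprime_subgroup_graph G"
  have "pverts ?P \<subseteq> Pow (carrier G)"
    by (auto simp: coprime_subgroup_graph_def Let_def dest: subgroup.mem_carrier)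
  then have fin: "finite (pverts ?P)"
    using assms by (simp add: finite_subset)
  have A: "parcs ?P \<subseteq> pverts ?P \<times> pverts ?P"
    by (auto simp: coprime_subgroup_graph_def Let_def)
  then have finA: "finite (parcs ?P)"
    using fin by (simp add: finite_subset)
  have S: "sym (parcs ?P)"
    unfolding sym_def coprime_subgroup_graph_def Let_def by (auto simp: coprime_commute)
  have L: "fst e \<noteq> snd e" if "e \<in> parcs ?P" for e
    using that unfolding coprime_subgroup_graph_def Let_def by force
  show ?thesis
  proof unfold_locales
    show "symmetric (with_proj ?P)"
      using S by (simp add: symmetric_def)
  next
    fix e assume e: "e \<in> parcs ?P"
    show "fst e \<in> pverts ?P" using A e by force
    show "snd e \<in> pverts ?P" using A e by force
    show "fst e \<noteq> snd e" using L e .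
  qed (fact fin finA)+
qed

end

(* Give every vertex v, and every pair {u, v} of distinct non-adjacent vertices, a prime of its
   own, and let d(v) be the product of all primes whose vertex set contains v. Distinct u, v have
   d(u), d(v) coprime iff they are adjacent, and the private primes make d injective. A cyclic
   group whose order is a common multiple of all d(v) has a subgroup of each order
   d(v); its order is taken to be the square of a common multiple, so that it is composite and
   different from every d(v). *)

theory Submission
  imports Defs
begin

lemma exists_prime_labelling:
  assumes "finite A"
  obtains p :: "'a \<Rightarrow> nat" where "inj_on p A" and "\<And>x. x \<in> A \<Longrightarrow> prime (p x)"
proof -
  obtain B :: "nat set" where "finite B" "card B = card A" and B: "B \<subseteq> {p. prime p}"
    using infinite_arbitrarily_large[OF primes_infinite] by blast
  with assms obtain p where "bij_betw p A B"
    by (metis finite_same_card_bij)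
  with B that[of p] show thesis
    by (auto simp: bij_betw_def)
qed

lemma exists_coprime_labelling:
  fixes V :: "'a set"
  assumes "finite V" and sym: "\<And>u v. adj u v \<Longrightarrow> adj v u"
  obtains d :: "'a \<Rightarrow> nat" and N :: nat
  where "N > 0"
    and "\<And>v. v \<in> V \<Longrightarrow> d v > 1"
    and "\<And>v. v \<in> V \<Longrightarrow> d v dvd N"
    and "inj_on d V"
    and "\<And>u v. \<lbrakk>u \<in> V; v \<in> V; u \<noteq> v\<rbrakk> \<Longrightarrow> coprime (d u) (d v) \<longleftrightarrow> adj u v"
proof -
  \<comment> \<open>The case \<open>u = v\<close> contributes the singletons \<open>{v}\<close>,
    which index the private primes. Since elements of \<open>E\<close> are unordered sets, a
    non-adjacent pair gets one prime shared by both of its vertices.\<close>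
  define E where "E = {{u, v} | u v. u \<in> V \<and> v \<in> V \<and> (u = v \<or> \<not> adj u v)}"
  have "E \<subseteq> Pow V"
    by (auto simp: E_def)
  with \<open>finite V\<close> have fin: "finite E"
    by (simp add: finite_subset)
  obtain p :: "'a set \<Rightarrow> nat" where inj: "inj_on p E" and prime: "\<And>e. e \<in> E \<Longrightarrow> prime (p e)"
    using exists_prime_labelling[OF fin] by blast
  define d where "d v = (\<Prod>e\<in>{e \<in> E. v \<in> e}. p e)" for v
  have prime_dvd: "q dvd d v \<longleftrightarrow> (\<exists>e\<in>E. v \<in> e \<and> q = p e)" if "prime q" for q v
  proof -
    have "q dvd d v \<longleftrightarrow> (\<exists>e\<in>{e \<in> E. v \<in> e}. q dvd p e)"
      unfolding d_def using fin that by (intro prime_dvd_prod_iff) auto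
    then show ?thesis
      using prime primes_dvd_imp_eq[OF that] by auto
  qed
  \<comment> \<open>Injectivity of \<open>p\<close> recovers \<open>e\<close> from its prime, so
    divisibility of \<open>d v\<close> becomes membership of \<open>v\<close> in
    \<open>e\<close>.\<close>
  have label_dvd: "p e dvd d v \<longleftrightarrow> v \<in> e" if "e \<in> E" for e v
    using that prime_dvd[OF prime[OF that], of v] inj by (auto simp: inj_on_def)
  have singleton: "{v} \<in> E" if "v \<in> V" for v
    using that by (auto simp: E_def)
  \<comment> \<open>The common multiple \<open>N\<close> will be the product of all the primes; each
    \<open>d v\<close> is a subproduct of it.\<close>
  have dvd: "d v dvd (\<Prod>e\<in>E. p e)" for v
    unfolding d_def using fin by (intro prod_dvd_prod_subset) auto
  have pos: "(\<Prod>e\<in>E. p e) > 0"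
    using prime by (intro prod_pos) (simp add: prime_gt_0_nat)
  have gt1: "d v > 1" if "v \<in> V" for v
  proof -
    have "d v > 0"
      using dvd_pos_nat[OF pos dvd] .
    moreover have "d v \<noteq> 1"
      using label_dvd[OF singleton[OF that]] prime[OF singleton[OF that]]
      by (metis nat_dvd_1_iff_1 not_prime_1 singletonI)
    ultimately show ?thesis
      by linarith
  qed
  have "inj_on d V"
  proof (rule inj_onI)
    fix u v assume "u \<in> V" "v \<in> V" "d u = d v"
    then show "u = v"
      using label_dvd[OF singleton[of u]] by (metis singletonD singletonI)
  qed
  moreover have "coprime (d u) (d v) \<longleftrightarrow> adj u v" if "u \<in> V" "v \<in> V" "u \<noteq> v" for u v
  proof
    assume cop: "coprime (d u) (d v)"
    show "adj u v"
    proof (rule ccontr)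
      assume "\<not> adj u v"
      with that have "{u, v} \<in> E"
        by (auto simp: E_def)
      then have "prime (p {u, v})" "p {u, v} dvd d u" "p {u, v} dvd d v"
        using prime label_dvd by auto
      with cop show False
        using coprime_common_divisor not_prime_unit by blast
    qed
  next
    assume adj: "adj u v"
    show "coprime (d u) (d v)"
    proof (rule ccontr)
      assume "\<not> coprime (d u) (d v)"
      \<comment> \<open>A common prime factor is \<open>p e\<close> for some \<open>e\<close>
        containing both \<open>u\<close> and \<open>v\<close>. As \<open>u\<close> and
        \<open>v\<close> differ, \<open>e\<close> is \<open>{u, v}\<close>, and its membership in
        \<open>E\<close> denies \<open>adj u v\<close> or \<open>adj v u\<close>; symmetry of
        \<open>adj\<close> refutes both.\<close>
      then obtain q where q: "prime q" "q dvd gcd (d u) (d v)"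
        using prime_factor_nat[of "gcd (d u) (d v)"] by (auto simp only: coprime_iff_gcd_eq_1)
      then obtain e where e: "e \<in> E" "u \<in> e" "q = p e"
        using prime_dvd[of q u] by auto
      with q have "v \<in> e"
        using label_dvd by auto
      with e that adj sym show False
        by (auto simp: E_def)
    qed
  qed
  ultimately show thesis
    using that pos gt1 dvd by blast
qed

text \<open>Since \<open>k\<close> divides \<open>n\<close>, reduction modulo \<open>n\<close>
  neither creates nor destroys divisibility by \<open>k\<close>. Closure under sums and inverses
  therefore reduces to the same fact in the integers.\<close>

lemma subgroup_integer_mod_group_multiples:
  assumes "n > 0" and "k dvd n"
  shows "subgroup {x \<in> {0..<int n}. int k dvd x} (integer_mod_group n)"
proof (rule group.subgroupI)
  show "group (integer_mod_group n)"
    by simp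
next
  show "{x \<in> {0..<int n}. int k dvd x} \<subseteq> carrier (integer_mod_group n)"
    using assms by (auto simp: carrier_integer_mod_group)
next
  have "0 \<in> {x \<in> {0..<int n}. int k dvd x}"
    using assms by auto
  then show "{x \<in> {0..<int n}. int k dvd x} \<noteq> {}"
    by blast
next
  fix x assume "x \<in> {x \<in> {0..<int n}. int k dvd x}"
  with assms show "inv\<^bsub>integer_mod_group n\<^esub> x \<in> {x \<in> {0..<int n}. int k dvd x}"
    by (simp add: carrier_integer_mod_group dvd_mod_iff)
next
  fix x y assume "x \<in> {x \<in> {0..<int n}. int k dvd x}" "y \<in> {x \<in> {0..<int n}. int k dvd x}"
  with assms show "x \<otimes>\<^bsub>integer_mod_group n\<^esub> y \<in> {x \<in> {0..<int n}. int k dvd x}"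
    by (simp add: dvd_mod_iff)
qed

lemma card_multiples_below:
  assumes "k > 0"
  shows "card {x \<in> {0..<int (k * d)}. int k dvd x} = d"
proof -
  have "{x \<in> {0..<int (k * d)}. int k dvd x} = (\<lambda>i. int k * int i) ` {..<d}"
  proof (intro subset_antisym subsetI)
    fix x assume "x \<in> {x \<in> {0..<int (k * d)}. int k dvd x}"
    then obtain y where y: "x = int k * y" "0 \<le> int k * y" "int k * y < int k * int d"
      by auto
    with assms have "0 \<le> y" "y < int d"
      by (auto simp: zero_le_mult_iff)
    with y show "x \<in> (\<lambda>i. int k * int i) ` {..<d}"
      by (intro image_eqI[of _ _ "nat y"]) auto
  next
    fix x assume "x \<in> (\<lambda>i. int k * int i) ` {..<d}"
    with assms show "x \<in> {x \<in> {0..<int (k * d)}. int k dvd x}"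
      by auto
  qed
  moreover have "inj_on (\<lambda>i. int k * int i) {..<d}"
    using assms by (auto simp: inj_on_def)
  ultimately show ?thesis
    by (simp add: card_image)
qed

lemma exists_subgroup_integer_mod_group:
  assumes "n > 0" and "d dvd n"
  obtains H where "subgroup H (integer_mod_group n)" and "card H = d"
proof -
  \<comment> \<open>\<open>k\<close> is the index of the subgroup sought: the multiples of
    \<open>k = n / d\<close> number exactly \<open>d\<close>.\<close>
  obtain k where k: "n = k * d"
    using assms(2) by (auto simp: dvd_def mult.commute)
  with assms have "k > 0" "k dvd n"
    by auto
  then show thesis
    using that subgroup_integer_mod_group_multiples[OF assms(1)] card_multiples_below[of k d] k
    by metis
qed

text \<open>The witness is the image of \<open>G\<close> under an isomorphism extending
  \<open>f\<close>. That \<open>f\<close> preserves adjacency makes the image a subgraph; that it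
  reflects adjacency makes it induced.\<close>

lemma (in digraph) digraph_iso_induced_subgraph:
  assumes P: "wf_digraph (with_proj P)"
    and inj: "inj_on f (verts G)" and sub: "f ` verts G \<subseteq> pverts P"
    and arc: "\<And>u v. \<lbrakk>u \<in> verts G; v \<in> verts G\<rbrakk> \<Longrightarrow> (f u, f v) \<in> parcs P \<longleftrightarrow> (u, v) \<in> arcs_ends G"
  shows "\<exists>H. induced_subgraph H (with_proj P) \<and> digraph_iso G H"
proof -
  \<comment> \<open>Arcs of \<open>G\<close> are abstract while those of \<open>P\<close> are pairs,
    so an arc is sent to the pair of images of its ends. This is injective because \<open>G\<close>
    has no parallel arcs.\<close>
  define h where "h = \<lparr>iso_verts = f, iso_arcs = (\<lambda>a. (f (tail G a), f (head G a))),
    iso_head = snd, iso_tail = fst\<rparr>"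
  have "inj_on (iso_arcs h) (arcs G)"
    using inj no_multi_arcs by (auto simp: h_def inj_on_def arc_to_ends_def)
  then have iso: "digraph_isomorphism h"
    using inj wf_digraph by (simp add: digraph_isomorphism_def h_def)
  have arcs: "arcs (app_iso h G) = {e \<in> parcs P. fst e \<in> f ` verts G \<and> snd e \<in> f ` verts G}"
    using arc by (fastforce simp: h_def arcs_ends_conv image_iff)
  have "induced_subgraph (app_iso h G) (with_proj P)"
  proof (rule induced_subgraphI)
    show "subgraph (app_iso h G) (with_proj P)"
    proof (rule subgraphI)
      show "compatible (with_proj P) (app_iso h G)"
        by (simp add: compatible_def h_def)
      show "wf_digraph (app_iso h G)"
        using iso by (rule wf_digraphI_app_iso)
    qed (use sub arcs P in \<open>auto simp: h_def\<close>)
  qed (use arcs in \<open>simp add: h_def\<close>)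
  with iso show ?thesis
    by (auto simp: digraph_iso_def)
qed

theorem theorem2p8:
  fixes G :: "('a, 'b) pre_digraph" and m :: nat
  assumes "graph G" and "card (verts G) = m" and "m > 0"
  shows "\<exists>m' :: nat. m' > 1 \<and> \<not> prime m' \<and>
    (\<exists>H. induced_subgraph H (with_proj (coprime_subgroup_graph (integer_mod_group m'))) \<and>
         digraph_iso G H)"
proof -
  interpret graph G by fact
  obtain d :: "'a \<Rightarrow> nat" and N where N: "N > 0"
    and gt1: "\<And>v. v \<in> verts G \<Longrightarrow> d v > 1"
    and dvd: "\<And>v. v \<in> verts G \<Longrightarrow> d v dvd N"
    and inj: "inj_on d (verts G)"
    and coprime: "\<And>u v. \<lbrakk>u \<in> verts G; v \<in> verts G; u \<noteq> v\<rbrakk> \<Longrightarrow>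
      coprime (d u) (d v) \<longleftrightarrow> (u, v) \<in> arcs_ends G"
    using exists_coprime_labelling[of "verts G" "\<lambda>u v. (u, v) \<in> arcs_ends G",
        OF finite_verts arcs_ends_symmetric[OF sym_arcs]]
    by metis
  \<comment> \<open>A vertex exists because \<open>m > 0\<close>; its label exceeds 1 and divides
    \<open>N\<close>, which excludes \<open>N = 1\<close> and so makes \<open>N * N\<close>
    composite.\<close>
  obtain v\<^sub>0 where "v\<^sub>0 \<in> verts G"
    using assms(2,3) by (metis card.empty less_irrefl ex_in_conv)
  with N gt1 dvd have "N > 1"
    by (meson dvd_imp_le less_le_trans)
  define n where "n = N * N"
  let ?Z = "integer_mod_group n"
  have "N < n" "\<not> prime n"
    using \<open>N > 1\<close> prime_product[of N N] by (auto simp: n_def)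
  with \<open>N > 1\<close> have n: "n > 1" "\<not> prime n" "N < n"
    by simp_all
  then have carrier: "carrier ?Z = {0..<int n}"
    by (simp add: carrier_integer_mod_group)
  have "\<exists>H. subgroup H ?Z \<and> card H = d v" if "v \<in> verts G" for v
    using exists_subgroup_integer_mod_group[of n "d v"] n dvd[OF that] by (auto simp: n_def)
  then obtain S where S: "\<And>v. v \<in> verts G \<Longrightarrow> subgroup (S v) ?Z"
    and card: "\<And>v. v \<in> verts G \<Longrightarrow> card (S v) = d v"
    by metis
  have inj_S: "inj_on S (verts G)"
    using inj card by (metis inj_on_def)
  \<comment> \<open>Comparison of orders suffices: \<open>1 < d v\<close>, and
    \<open>d v \<le> N < n\<close>.\<close>
  have proper: "S v \<noteq> carrier ?Z \<and> S v \<noteq> {\<one>\<^bsub>?Z\<^esub>}" if "v \<in> verts G" for v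
  proof -
    have "d v < n"
      using dvd_imp_le[OF dvd[OF that] N] n by simp
    then show ?thesis
      using card[OF that] gt1[OF that] carrier by auto
  qed
  let ?P = "coprime_subgroup_graph ?Z"
  interpret P: pair_graph ?P
    using carrier by (intro pair_graph_coprime_subgroup_graph) simp
  have "(S u, S v) \<in> parcs ?P \<longleftrightarrow> (u, v) \<in> arcs_ends G"
    if "u \<in> verts G" "v \<in> verts G" for u v
  \<comment> \<open>On the diagonal both sides are false, as neither graph has loops. Off it,
    \<open>S u\<close> and \<open>S v\<close> are distinct because their orders are, and only
    coprimality remains to be compared.\<close>
  proof (cases "u = v")
    case True
    then show ?thesis
      using no_loops by (auto simp: coprime_subgroup_graph_def Let_def arcs_ends_conv)
  next
    case False
    with inj_S that have "S u \<noteq> S v"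
      by (auto simp: inj_on_def)
    with S proper card coprime[OF that False] that show ?thesis
      by (simp add: coprime_subgroup_graph_def Let_def)
  qed
  moreover have "S ` verts G \<subseteq> pverts ?P"
    using S proper by (auto simp: coprime_subgroup_graph_def Let_def)
  ultimately show ?thesis
    using digraph_iso_induced_subgraph[OF P.wf_digraph inj_S] n by blast
qed

end
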